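(* Let $0<n\le m$ be integers, $c\in\mathbb{R}^n$, $A\in\mathbb{R}^{m\times n}$, $b\in\mathbb{R}^m$, and assume that the linear optimization problem $\min_{x\in\mathbb{R}^n}\{c^\top x: Ax\le b\}$ has an optimal solution. Let $X=\{x\in\mathbb{R}^n:Ax\le b\}$, $0<\alpha<1$, $\gamma>0$, and let $F_{DR}:\mathbb{R}^n\to\mathbb{R}^n$ be the Douglas-Rachford operator $$F_{DR}(x)=(1-2\alpha)x+2\alpha\Pi_X(x)-2\alpha\gamma c.$$ Then, when $R>0$ is sufficiently small, the error-bound condition with radius $R$ holds for $F_{DR}$ with a constant $K_{F_{DR}}$ satisfying $$\sqrt{\tfrac{1-\alpha}{\alpha}}\le K_{F_{DR}}\le\tfrac{1}{2\alpha}.$$ Consequently, the Douglas-Rachford algorithm $w_{k+1}=F_{DR}(w_k)$ converges linearly with rate $\rho_{F_{DR}}\le 1-2\alpha(1-\alpha)$. In particular, for the ADMM operator $F_{ADMM}$ (with any penalty parameter $\rho>0$) and the corresponding ADMM algorithm $w_{k+1}=F_{ADMM}(w_k)$ one obtains $K_{F_{ADMM}}=1$ and $\rho_{F_{ADMM}}\le\tfrac12$ respectively.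
   Context: $\|\cdot\|$ is the Euclidean norm, $\operatorname{dist}(x,S)=\inf_{y\in S}\|x-y\|$, $\Pi_X$ is the Euclidean projection onto $X$, and $\mathcal{F}_F:=\{x:F(x)=x\}$. The error-bound condition with radius $R>0$ holds for $F$ with constant $K_F>0$ if for all $x$: $\operatorname{dist}(x,\mathcal{F}_F)\le R$ implies $\operatorname{dist}(x,\mathcal{F}_F)\le K_F\|F(x)-x\|$. The iteration $w_{k+1}=F(w_k)$ converges linearly with rate $\rho_F$ means: from any starting point $w_0$, $w_k$ converges (linearly) to a point of $\mathcal{F}_F$, and for every $k$ with $\operatorname{dist}(w_k,\mathcal{F}_F)\le R$ one has $\operatorname{dist}(w_{k+1},\mathcal{F}_F)\le\rho_F\operatorname{dist}(w_k,\mathcal{F}_F)$, where $R>0$ is a sufficiently small radius for which the error-bound condition holds ($R$ may depend on the problem data). $F_{DR}$ is the operator $x\mapsto(1-\alpha)x+\alpha\operatorname{ref}_{\gamma g}(\operatorname{ref}_{\gamma f}(x))$ for $g(x)=c^\top x$ and $f=\delta_X$ (the indicator function of $X$, $0$ on $X$ and $+\infty$ outside), where $\operatorname{prox}_{\gamma h}(x)=\operatorname{argmin}_u\{\gamma h(u)+\frac12\|u-x\|^2\}$ and $\operatorname{ref}_{\gamma h}(x)=2\operatorname{prox}_{\gamma h}(x)-x$. The ADMM operator with penalty parameter $\rho>0$, for the splitting $\min\{f(x)+g(y):-x+y=0\}$, is defined by $\rho F_{ADMM}(\tfrac1\rho w)=\tfrac12w+\tfrac12\operatorname{ref}_{\rho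 g}(\operatorname{ref}_{\rho f}(w))$ for all $w\in\mathbb{R}^n$ (that is, a rescaling of the Douglas-Rachford operator with $\alpha=\tfrac12$ and step $\rho$). *)

theory Defs
  imports "HOL-Analysis.Analysis"
begin

definition fixed_points :: "('a \<Rightarrow> 'a) \<Rightarrow> 'a set" where
  "fixed_points F = {x. F x = x}"

text \<open>
  Since \<^const>\<open>infdist\<close> to the empty set is 0 by convention, this holds trivially when there are
  no fixed points, just as it does with the convention that the distance is infinite.
\<close>

definition error_bound :: "('a::real_normed_vector \<Rightarrow> 'a) \<Rightarrow> real \<Rightarrow> real \<Rightarrow> bool" where
  "error_bound F R K \<longleftrightarrow> R > 0 \<and> K > 0 \<and>
     (\<forall>x. infdist x (fixed_points F) \<le> R \<longrightarrow> infdist x (fixed_points F) \<le> K * norm (F x - x))"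

definition converges_linearly_to :: "(nat \<Rightarrow> 'a::metric_space) \<Rightarrow> 'a \<Rightarrow> bool" where
  "converges_linearly_to w l \<longleftrightarrow>
     (\<exists>C q. 0 \<le> q \<and> q < 1 \<and> (\<forall>k. dist (w k) l \<le> C * q ^ k))"

text \<open>
  The rate \<open>r\<close> is the factor by which the distance to the set of fixed points decreases in each
  step once it is at most \<open>R\<close>, where \<open>R\<close> is a radius for which an error bound holds. It need not be
  the geometric factor of the iterates themselves, which may depend on the starting point.
\<close>

definition converges_linearly_with_rate ::
  "('a::real_normed_vector \<Rightarrow> 'a) \<Rightarrow> real \<Rightarrow> real \<Rightarrow> bool" where
  "converges_linearly_with_rate F R r \<longleftrightarrow>
     0 \<le> r \<and> (\<exists>K. error_bound F R K) \<and>
     (\<forall>w. (\<forall>k. w (Suc k) = F (w k)) \<longrightarrow>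
        (\<exists>l \<in> fixed_points F. converges_linearly_to w l) \<and>
        (\<forall>k. infdist (w k) (fixed_points F) \<le> R \<longrightarrow>
           infdist (w (Suc k)) (fixed_points F) \<le> r * infdist (w k) (fixed_points F)))"

definition prox :: "real \<Rightarrow> ('a::real_inner \<Rightarrow> ereal) \<Rightarrow> 'a \<Rightarrow> 'a" where
  "prox \<gamma> h x = arg_min (\<lambda>u. ereal \<gamma> * h u + ereal (1/2 * (norm (u - x))\<^sup>2)) (\<lambda>u. True)"

definition refl_prox :: "real \<Rightarrow> ('a::real_inner \<Rightarrow> ereal) \<Rightarrow> 'a \<Rightarrow> 'a" where
  "refl_prox \<gamma> h x = 2 *\<^sub>R prox \<gamma> h x - x"

definition dr_operator ::
  "real \<Rightarrow> real \<Rightarrow> ('a::real_inner \<Rightarrow> ereal) \<Rightarrow> ('a \<Rightarrow> ereal) \<Rightarrow> 'a \<Rightarrow> 'a" where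
  "dr_operator \<alpha> \<gamma> f g x =
     (1 - \<alpha>) *\<^sub>R x + \<alpha> *\<^sub>R refl_prox \<gamma> g (refl_prox \<gamma> f x)"

text \<open>
  The operator is given implicitly by the identity \<open>admm_operator_scaled\<close> below; the definition
  solves it for the value at an arbitrary point.
\<close>

definition admm_operator ::
  "real \<Rightarrow> ('a::real_inner \<Rightarrow> ereal) \<Rightarrow> ('a \<Rightarrow> ereal) \<Rightarrow> 'a \<Rightarrow> 'a" where
  "admm_operator \<beta> f g u =
     (1 / \<beta>) *\<^sub>R ((1/2) *\<^sub>R (\<beta> *\<^sub>R u) + (1/2) *\<^sub>R refl_prox \<beta> g (refl_prox \<beta> f (\<beta> *\<^sub>R u)))"

lemma admm_operator_scaled:
  assumes "\<beta> > 0"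
  shows "\<beta> *\<^sub>R admm_operator \<beta> f g ((1 / \<beta>) *\<^sub>R w) =
    (1/2) *\<^sub>R w + (1/2) *\<^sub>R refl_prox \<beta> g (refl_prox \<beta> f w)"
  using assms by (simp add: admm_operator_def)

definition set_indicator :: "'a set \<Rightarrow> 'a \<Rightarrow> ereal" where
  "set_indicator S x = (if x \<in> S then 0 else \<infinity>)"

definition linear_cost :: "'a::real_inner \<Rightarrow> 'a \<Rightarrow> ereal" where
  "linear_cost c x = ereal (c \<bullet> x)"

text \<open>The order on vectors is componentwise.\<close>

definition feasible_set :: "real^'n^'m \<Rightarrow> real^'m \<Rightarrow> (real^'n) set" where
  "feasible_set A b = {x. A *v x \<le> b}"

definition DR_LP ::
  "real^'n^'m \<Rightarrow> real^'m \<Rightarrow> real^'n \<Rightarrow> real \<Rightarrow> real \<Rightarrow> real^'n \<Rightarrow> real^'n" where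
  "DR_LP A b c \<alpha> \<gamma> = dr_operator \<alpha> \<gamma> (set_indicator (feasible_set A b)) (linear_cost c)"

definition ADMM_LP ::
  "real^'n^'m \<Rightarrow> real^'m \<Rightarrow> real^'n \<Rightarrow> real \<Rightarrow> real^'n \<Rightarrow> real^'n" where
  "ADMM_LP A b c \<beta> = admm_operator \<beta> (set_indicator (feasible_set A b)) (linear_cost c)"

end

theory Submission
  imports Defs
begin

text \<open>
  Write \<open>S\<close> for the set of optimal solutions of the linear program, \<open>T\<close> for the Douglas-Rachford
  map and \<open>y = x + \<gamma> c\<close>. Since \<open>T x - x = 2\<alpha> (\<Pi>\<^sub>X x - y)\<close>, the fixed points of \<open>T\<close> are the
  points of \<open>S\<close> translated by \<open>- \<gamma> c\<close>, and the distance of \<open>x\<close> to them is the distance of \<open>y\<close> to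
  \<open>S\<close>. The key fact is that close to the fixed points the projection onto \<open>X\<close> hits the optimal face
  exactly: \<open>\<Pi>\<^sub>X (y - \<gamma> c) = \<Pi>\<^sub>S y\<close> whenever \<open>dist(y, S)\<close> is small (\<open>closest_point_shifted\<close>).
  There the displacement \<open>\<parallel>T x - x\<parallel>\<close> equals \<open>2\<alpha>\<close> times the distance to the fixed points, so the
  error bound holds with the constant \<open>1/(2\<alpha>)\<close>, and with no smaller one unless every point is
  fixed. The remaining comparison \<open>sqrt ((1 - \<alpha>)/\<alpha>) \<le> 1/(2\<alpha>)\<close> is \<open>4\<alpha>(1 - \<alpha>) \<le> 1\<close>.

  The projection identity is an exact penalty argument. A linear program has a weak sharp minimum:
  on \<open>X\<close> the excess cost is at least \<open>\<mu> dist(x, S)\<close> for some \<open>\<mu> > 0\<close> (\<open>polyhedron_sharp_minimum\<close>).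
  Projecting \<open>y - \<gamma> c\<close> onto \<open>X\<close> minimizes \<open>\<parallel>x - y\<parallel>\<^sup>2/2 + \<gamma> (c \<bullet> x)\<close> over \<open>X\<close>; if
  \<open>dist(y, S) \<le> \<gamma> \<mu>\<close>, what is gained in the quadratic term by leaving \<open>S\<close> is paid for by the cost.
  The sharp minimum comes from compactness: the unit direction pointing to a
  feasible point from its projection onto the optimal set lies in one of finitely many compact sets,
  one for each set of active constraints, on each of which the cost increases at a positive rate.

  For the convergence, firm nonexpansiveness of the projection makes every step decrease the squared
  distance to each fixed point by at least \<open>(1 - \<alpha>)/\<alpha>\<close> times the squared displacement
  (\<open>dr_step_fejer\<close>). This alone forces every orbit to converge to a fixed point; combined with the
  error bound it makes the distance to the fixed points shrink geometrically
  (\<open>error_bound_imp_linear_convergence\<close>).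

  The ADMM operator is the Douglas-Rachford map for \<open>\<alpha> = 1/2\<close>, \<open>\<gamma> = 1\<close> and the scaled polyhedron
  \<open>{x. A x \<le> b/\<beta>}\<close>, so its statements are an instance of the above, in which
  \<open>1/(2\<alpha>) = sqrt ((1 - \<alpha>)/\<alpha>) = 1\<close>.
\<close>

section \<open>Distances and projections\<close>

lemma infdist_closest_point:
  fixes S :: "'a::euclidean_space set"
  assumes "closed S" "S \<noteq> {}"
  shows "infdist x S = dist x (closest_point S x)"
  using setdist_closest_point[OF assms] by (simp add: infdist_eq_setdist)

lemma closest_point_eqI:
  fixes S :: "'a::euclidean_space set"
  assumes "convex S" "closed S" "p \<in> S"
    and obtuse: "\<And>u. u \<in> S \<Longrightarrow> (x - p) \<bullet> (u - p) \<le> 0"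
  shows "closest_point S x = p"
proof -
  have "dist x p \<le> dist x u" if "u \<in> S" for u
  proof -
    have "(norm (x - u))\<^sup>2 = (norm (x - p))\<^sup>2 - 2 * ((x - p) \<bullet> (u - p)) + (norm (u - p))\<^sup>2"
      unfolding power2_norm_eq_inner by (simp add: algebra_simps inner_commute)
    then have "(norm (x - p))\<^sup>2 \<le> (norm (x - u))\<^sup>2"
      using obtuse[OF that] zero_le_power2[of "norm (u - p)"] by linarith
    then show ?thesis
      by (simp add: dist_norm)
  qed
  then show ?thesis
    using closest_point_unique[OF assms(1-3)] by simp
qed

lemma closest_point_firmly_nonexpansive:
  fixes X :: "'a::euclidean_space set"
  assumes "convex X" "closed X" "X \<noteq> {}"
  shows "(norm (closest_point X x - closest_point X y))\<^sup>2
    \<le> (closest_point X x - closest_point X y) \<bullet> (x - y)"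
proof -
  let ?p = "closest_point X x" and ?q = "closest_point X y"
  have "(x - ?p) \<bullet> (?q - ?p) \<le> 0" "(y - ?q) \<bullet> (?p - ?q) \<le> 0"
    using assms by (simp_all add: closest_point_dot closest_point_in_set)
  then show ?thesis
    unfolding power2_norm_eq_inner by (simp add: algebra_simps inner_commute)
qed

lemma closest_point_scaled_image:
  fixes X :: "'a::euclidean_space set"
  assumes X: "convex X" "closed X" "X \<noteq> {}"
  shows "closest_point ((*\<^sub>R) t ` X) (t *\<^sub>R x) = t *\<^sub>R closest_point X x"
proof (rule closest_point_eqI)
  show "convex ((*\<^sub>R) t ` X)" "closed ((*\<^sub>R) t ` X)"
    using X by (auto intro: convex_scaling closed_scaling)
  show "t *\<^sub>R closest_point X x \<in> (*\<^sub>R) t ` X"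
    using closest_point_in_set X by blast
  fix u assume "u \<in> (*\<^sub>R) t ` X"
  then obtain v where v: "v \<in> X" "u = t *\<^sub>R v"
    by blast
  have "(x - closest_point X x) \<bullet> (v - closest_point X x) \<le> 0"
    using X v by (simp add: closest_point_dot)
  then have "t\<^sup>2 * ((x - closest_point X x) \<bullet> (v - closest_point X x)) \<le> 0"
    by (simp add: mult_nonneg_nonpos)
  then show "(t *\<^sub>R x - t *\<^sub>R closest_point X x) \<bullet> (u - t *\<^sub>R closest_point X x) \<le> 0"
    by (simp add: v power2_eq_square flip: scaleR_diff_right)
qed

lemma infdist_translated_set:
  fixes S :: "'a::real_normed_vector set"
  shows "infdist x {y. y + a \<in> S} = infdist (x + a) S"
proof -
  have eq: "{y. y + a \<in> S} = (\<lambda>s. s - a) ` S"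
    by (auto simp: image_iff) (metis add_diff_cancel)
  show ?thesis
    by (simp add: eq infdist_def image_image dist_norm algebra_simps)
qed

section \<open>Error bounds and linear convergence of averaged maps\<close>

text \<open>
  The distance to every fixed point decreases along an orbit, so the decreases are summable and the
  displacements tend to 0. By continuity any cluster point is then a fixed point, and the distance
  to it, being monotone, tends to 0 along the whole orbit.
\<close>

lemma fejer_iterates_converge:
  fixes F :: "'a::euclidean_space \<Rightarrow> 'a"
  assumes cont: "continuous_on UNIV F" and ne: "fixed_points F \<noteq> {}" and \<kappa>: "\<kappa> > 0"
    and fejer: "\<And>x z. z \<in> fixed_points F \<Longrightarrow>
      (norm (F x - z))\<^sup>2 \<le> (norm (x - z))\<^sup>2 - \<kappa> * (norm (F x - x))\<^sup>2"
    and w: "\<And>k. w (Suc k) = F (w k)"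
  shows "\<exists>l \<in> fixed_points F. w \<longlonglongrightarrow> l"
proof -
  have mono: "dist (w (Suc k)) z \<le> dist (w k) z" if "z \<in> fixed_points F" for z k
  proof -
    have "(norm (w (Suc k) - z))\<^sup>2 \<le> (norm (w k - z))\<^sup>2 - \<kappa> * (norm (F (w k) - w k))\<^sup>2"
      using fejer[OF that, of "w k"] by (simp add: w)
    also have "\<dots> \<le> (norm (w k - z))\<^sup>2"
      using \<kappa> by simp
    finally show ?thesis
      by (simp add: dist_norm)
  qed
  then have dec: "decseq (\<lambda>k. dist (w k) z)" if "z \<in> fixed_points F" for z
    using that by (simp add: decseq_Suc_iff)
  obtain z where z: "z \<in> fixed_points F"
    using ne by blast
  obtain a where a: "(\<lambda>k. dist (w k) z) \<longlonglongrightarrow> a"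
    using decseq_convergent[OF dec[OF z], of 0] by auto
  have "(\<lambda>k. ((dist (w k) z)\<^sup>2 - (dist (w (Suc k)) z)\<^sup>2) / \<kappa>) \<longlonglongrightarrow> (a\<^sup>2 - a\<^sup>2) / \<kappa>"
    by (intro tendsto_intros a LIMSEQ_Suc) (use \<kappa> in auto)
  then have bound0: "(\<lambda>k. ((dist (w k) z)\<^sup>2 - (dist (w (Suc k)) z)\<^sup>2) / \<kappa>) \<longlonglongrightarrow> 0"
    by simp
  have "(\<lambda>k. (norm (F (w k) - w k))\<^sup>2) \<longlonglongrightarrow> 0"
  proof (rule tendsto_sandwich[OF _ _ tendsto_const bound0])
    show "\<forall>\<^sub>F k in sequentially. (norm (F (w k) - w k))\<^sup>2
        \<le> ((dist (w k) z)\<^sup>2 - (dist (w (Suc k)) z)\<^sup>2) / \<kappa>"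
      using fejer[OF z] \<kappa> by (simp add: w dist_norm field_simps)
  qed auto
  from tendsto_real_sqrt[OF this]
  have res: "(\<lambda>k. F (w k) - w k) \<longlonglongrightarrow> 0"
    by (simp add: tendsto_norm_zero_iff)
  have "range w \<subseteq> cball z (dist (w 0) z)"
    using decseqD[OF dec[OF z], of 0] by (auto simp: dist_commute)
  then have "bounded (range w)"
    using bounded_cball bounded_subset by blast
  then obtain l \<sigma> where \<sigma>: "strict_mono (\<sigma> :: nat \<Rightarrow> nat)" and l: "(w \<circ> \<sigma>) \<longlonglongrightarrow> l"
    using bounded_imp_convergent_subsequence by blast
  have "(\<lambda>k. F (w (\<sigma> k)) - w (\<sigma> k)) \<longlonglongrightarrow> F l - l"
    using l cont by (auto simp: o_def continuous_on_def intro!: tendsto_diff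
        intro: continuous_on_tendsto_compose[OF cont])
  moreover have "(\<lambda>k. F (w (\<sigma> k)) - w (\<sigma> k)) \<longlonglongrightarrow> 0"
    using LIMSEQ_subseq_LIMSEQ[OF res \<sigma>] by (simp add: o_def)
  ultimately have "F l - l = 0"
    using LIMSEQ_unique by blast
  then have lF: "l \<in> fixed_points F"
    by (simp add: fixed_points_def)
  obtain e where e: "(\<lambda>k. dist (w k) l) \<longlonglongrightarrow> e"
    using decseq_convergent[OF dec[OF lF], of 0] by auto
  have "(\<lambda>k. dist (w (\<sigma> k)) l) \<longlonglongrightarrow> e"
    using LIMSEQ_subseq_LIMSEQ[OF e \<sigma>] by (simp add: o_def)
  moreover have "(\<lambda>k. dist (w (\<sigma> k)) l) \<longlonglongrightarrow> 0"
    using iffD1[OF tendsto_dist_iff l] by (simp add: o_def)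
  ultimately have "e = 0"
    using LIMSEQ_unique by blast
  then show ?thesis
    using lF e iffD2[OF tendsto_dist_iff, of w l] by auto
qed

text \<open>
  Let \<open>d\<close> be the distance of \<open>x\<close> to the fixed points and \<open>z\<close> a nearest one. The error bound turns
  the decrease by \<open>\<kappa> \<parallel>F x - x\<parallel>\<^sup>2\<close> into a decrease by \<open>(\<kappa>/K\<^sup>2) d\<^sup>2\<close>, which gives the rate. It is
  a positive \<open>r\<close> rather than the square root of \<open>1 - \<kappa>/K\<^sup>2\<close>, since that root may be 0 and then
  no multiple of its powers bounds the initial part of an orbit. An orbit is eventually close enough
  for the error bound, and its distance to the limit is always at most twice its distance to the
  fixed points, since it can never move away from a nearest fixed point.
\<close>

lemma error_bound_imp_linear_convergence:
  fixes F :: "'a::euclidean_space \<Rightarrow> 'a"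
  assumes cont: "continuous_on UNIV F" and ne: "fixed_points F \<noteq> {}" and \<kappa>: "\<kappa> > 0"
    and fejer: "\<And>x z. z \<in> fixed_points F \<Longrightarrow>
      (norm (F x - z))\<^sup>2 \<le> (norm (x - z))\<^sup>2 - \<kappa> * (norm (F x - x))\<^sup>2"
    and eb: "error_bound F R K"
    and r: "0 < r" "r < 1" "1 - \<kappa> / K\<^sup>2 \<le> r\<^sup>2"
  shows "converges_linearly_with_rate F R r"
proof -
  let ?S = "fixed_points F"
  have R: "R > 0" and K: "K > 0"
    using eb by (auto simp: error_bound_def)
  have nonexp: "dist (F x) z \<le> dist x z" if "z \<in> ?S" for x z
  proof -
    have "(norm (F x - z))\<^sup>2 \<le> (norm (x - z))\<^sup>2"
      using fejer[OF that, of x] \<kappa> by (smt (verit) mult_nonneg_nonneg zero_le_power2)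
    then show ?thesis
      by (simp add: dist_norm)
  qed
  have "?S = {x. F x = id x}"
    by (simp add: fixed_points_def)
  then have clo: "closed ?S"
    using closed_Collect_eq[of F id] cont by (simp add: continuous_on_id)
  define pr where "pr = closest_point ?S"
  have pr: "pr x \<in> ?S" "infdist x ?S = dist x (pr x)" for x
    using closest_point_in_set[OF clo ne] infdist_closest_point[OF clo ne] by (auto simp: pr_def)
  have contract: "infdist (F x) ?S \<le> r * infdist x ?S" if x: "infdist x ?S \<le> R" for x
  proof -
    define d where "d = norm (x - pr x)"
    have d: "infdist x ?S = d"
      by (simp add: pr d_def dist_norm)
    have "d \<le> K * norm (F x - x)"
      using eb x unfolding error_bound_def d[symmetric] by blast
    then have "(d / K)\<^sup>2 \<le> (norm (F x - x))\<^sup>2"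
      using K by (intro power_mono) (auto simp: d_def field_simps)
    then have "(norm (F x - pr x))\<^sup>2 \<le> d\<^sup>2 - \<kappa> * (d / K)\<^sup>2"
      using fejer[OF pr(1)[of x], of x] \<kappa>
      by (smt (verit) d_def mult_left_mono)
    also have "\<dots> = (1 - \<kappa> / K\<^sup>2) * d\<^sup>2"
      by (simp add: algebra_simps power_divide)
    also have "\<dots> \<le> (r * d)\<^sup>2"
      using mult_right_mono[OF r(3), of "d\<^sup>2"] by (simp add: power_mult_distrib)
    finally have "norm (F x - pr x) \<le> r * d"
      by (rule power2_le_imp_le) (use r in \<open>simp add: d_def\<close>)
    then show ?thesis
      using infdist_le[OF pr(1)[of x], of "F x"] d by (simp add: dist_norm)
  qed
  have "\<exists>l\<in>?S. converges_linearly_to w l" if w: "\<And>k. w (Suc k) = F (w k)" for w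
  proof -
    let ?d = "\<lambda>k. infdist (w k) ?S"
    obtain l where l: "l \<in> ?S" "w \<longlonglongrightarrow> l"
      using fejer_iterates_converge[of F \<kappa> w, OF cont ne \<kappa> fejer w] by blast
    have dec: "?d (Suc k) \<le> ?d k" for k
      using infdist_le2[OF pr(1)[of "w k"], of "w (Suc k)"] nonexp[OF pr(1)[of "w k"], of "w k"]
      by (simp add: w pr(2))
    then have dec0: "?d k \<le> ?d 0" for k
      by (induction k) (auto intro: order_trans)
    have "\<forall>\<^sub>F k in sequentially. dist (w k) l < R"
      using l(2) R by (simp add: tendsto_iff)
    then obtain N where N: "\<And>k. k \<ge> N \<Longrightarrow> ?d k \<le> R"
      unfolding eventually_sequentially by (meson infdist_le2 l(1) less_imp_le)
    \<comment> \<open>Dividing by \<open>r ^ N\<close> absorbs the first \<open>N\<close> steps, in which the distance merely does not grow.\<close>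
    define C where "C = ?d 0 / r ^ N"
    have geo: "?d k \<le> C * r ^ k" for k
    proof (induction k)
      case 0
      show ?case
        using r by (simp add: C_def divide_simps mult_left_le infdist_nonneg power_le_one)
    next
      case (Suc k)
      show ?case
      proof (cases "N \<le> k")
        case True
        have "?d (Suc k) \<le> r * ?d k"
          using contract[OF N[OF True]] by (simp add: w)
        also have "\<dots> \<le> r * (C * r ^ k)"
          using Suc r by (intro mult_left_mono) auto
        finally show ?thesis
          by (simp add: algebra_simps)
      next
        case False
        then have "r ^ N \<le> r ^ Suc k"
          using r by (intro power_decreasing) auto
        then have "?d 0 \<le> C * r ^ Suc k"
          unfolding C_def using r
          by (simp add: divide_simps mult_left_mono infdist_nonneg del: power_Suc)
        then show ?thesis
          using dec0[of "Suc k"] by linarith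
      qed
    qed
    have tail: "dist (w k) l \<le> 2 * ?d k" for k
    proof -
      let ?z = "pr (w k)"
      have "dist (w (k + j)) ?z \<le> ?d k" for j
        by (induction j) (use nonexp[OF pr(1)] in \<open>auto simp: w pr(2) intro: order_trans\<close>)
      moreover have "(\<lambda>j. dist (w (k + j)) ?z) \<longlonglongrightarrow> dist l ?z"
        using LIMSEQ_ignore_initial_segment[OF l(2), of k]
        by (intro tendsto_intros) (simp add: add.commute)
      ultimately have "dist l ?z \<le> ?d k"
        by (meson LIMSEQ_le_const2)
      then show ?thesis
        using dist_triangle2[of "w k" l ?z] pr(2)[of "w k"] by linarith
    qed
    have "dist (w k) l \<le> (2 * C) * r ^ k" for k
      using tail[of k] geo[of k] by (simp add: mult.assoc)
    then show ?thesis
      using l(1) r unfolding converges_linearly_to_def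
      by (intro bexI[of _ l] exI[of _ "2 * C"] exI[of _ r]) auto
  qed
  then show ?thesis
    using eb contract r by (auto simp: converges_linearly_with_rate_def)
qed


section \<open>Weak sharp minima of linear programs\<close>

definition minimizers :: "'a::real_inner \<Rightarrow> 'a set \<Rightarrow> 'a set" where
  "minimizers c X = {x \<in> X. \<forall>y\<in>X. c \<bullet> x \<le> c \<bullet> y}"

lemma minimizers_eq_sublevel:
  assumes "s \<in> minimizers c X"
  shows "minimizers c X = X \<inter> {x. c \<bullet> x \<le> c \<bullet> s}"
  using assms by (force simp: minimizers_def)

lemma closed_minimizers:
  assumes "closed X"
  shows "closed (minimizers c X)"
proof (cases "minimizers c X = {}")
  case False
  then obtain s where "s \<in> minimizers c X"
    by blast
  then show ?thesis
    using assms minimizers_eq_sublevel[of s c X] by (simp add: closed_Int closed_halfspace_le)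
qed simp

lemma convex_minimizers:
  assumes "convex X"
  shows "convex (minimizers c X)"
proof (cases "minimizers c X = {}")
  case False
  then obtain s where "s \<in> minimizers c X"
    by blast
  then show ?thesis
    using assms minimizers_eq_sublevel[of s c X] by (simp add: convex_Int convex_halfspace_le)
qed simp

text \<open>
  In the application \<open>J\<close> is the set of constraints active at an optimal point, and \<open>d\<close> is a feasible
  direction that is normal to the optimal face, hence makes no acute angle with any feasible
  direction \<open>e\<close> along which the cost does not increase. Such a \<open>d\<close> must itself
  increase the cost, as otherwise \<open>e = d\<close> gives \<open>d \<bullet> d \<le> 0\<close>; the unit vectors among these \<open>d\<close> form
  a compact set, whence the uniform bound.
\<close>

lemma outward_normal_cost_pos:
  fixes a :: "'i \<Rightarrow> 'a::euclidean_space"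
  shows "\<exists>\<mu>>0. \<forall>d. norm d = 1 \<and> (\<forall>i\<in>J. a i \<bullet> d \<le> 0) \<and>
      (\<forall>e. (\<forall>i\<in>J. a i \<bullet> e \<le> 0) \<and> c \<bullet> e \<le> 0 \<longrightarrow> d \<bullet> e \<le> 0) \<longrightarrow> \<mu> \<le> c \<bullet> d"
proof -
  define T where "T = {e. (\<forall>i\<in>J. a i \<bullet> e \<le> 0)}"
  define D where "D = sphere 0 1 \<inter> (T \<inter> (\<Inter>e\<in>{e\<in>T. c \<bullet> e \<le> 0}. {d. e \<bullet> d \<le> 0}))"
  have "T = (\<Inter>i\<in>J. {e. a i \<bullet> e \<le> 0})"
    by (auto simp: T_def)
  then have "closed T"
    by (auto intro: closed_INT closed_halfspace_le)
  then have "compact D"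
    unfolding D_def
    by (intro compact_Int_closed compact_sphere closed_Int closed_INT ballI closed_halfspace_le)
  have pos: "c \<bullet> d > 0" if "d \<in> D" for d
  proof (rule ccontr)
    assume "\<not> c \<bullet> d > 0"
    then have "d \<bullet> d \<le> 0"
      using that by (auto simp: D_def)
    then show False
      using that by (simp add: D_def dot_square_norm)
  qed
  have "\<exists>\<mu>>0. \<forall>d\<in>D. \<mu> \<le> c \<bullet> d"
  proof (cases "D = {}")
    case True
    then show ?thesis
      by (intro exI[of _ 1]) simp
  next
    case False
    have "continuous_on D (\<lambda>d. c \<bullet> d)"
      by (intro continuous_intros)
    then obtain d0 where "d0 \<in> D" "\<forall>d\<in>D. c \<bullet> d0 \<le> c \<bullet> d"
      using continuous_attains_inf[OF \<open>compact D\<close> False] by blast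
    then show ?thesis
      using pos by blast
  qed
  moreover have "d \<in> D" if "norm d = 1 \<and> (\<forall>i\<in>J. a i \<bullet> d \<le> 0) \<and>
      (\<forall>e. (\<forall>i\<in>J. a i \<bullet> e \<le> 0) \<and> c \<bullet> e \<le> 0 \<longrightarrow> d \<bullet> e \<le> 0)" for d
    using that by (auto simp: D_def T_def inner_commute)
  ultimately show ?thesis
    by blast
qed

text \<open>
  For \<open>x\<close> feasible with projection \<open>q\<close> onto the optimal set, the direction from \<open>q\<close> to \<open>x\<close> satisfies
  the conditions of \<open>outward_normal_cost_pos\<close> for the constraints active at \<open>q\<close>. There are only
  finitely many sets of active constraints, so the smallest of the constants serves for all \<open>x\<close>, even
  when the optimal set is unbounded.
\<close>

lemma polyhedron_sharp_minimum:
  fixes a :: "'i \<Rightarrow> 'a::euclidean_space" and \<beta> :: "'i \<Rightarrow> real" and c :: 'a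
  assumes "finite I" and X_def: "X = {x. \<forall>i\<in>I. a i \<bullet> x \<le> \<beta> i}"
  shows "\<exists>\<mu>>0. \<forall>x\<in>X. \<forall>s\<in>minimizers c X. \<mu> * infdist x (minimizers c X) \<le> c \<bullet> x - c \<bullet> s"
proof -
  let ?S = "minimizers c X"
  let ?D = "\<lambda>J d. norm d = 1 \<and> (\<forall>i\<in>J. a i \<bullet> d \<le> 0) \<and>
      (\<forall>e. (\<forall>i\<in>J. a i \<bullet> e \<le> 0) \<and> c \<bullet> e \<le> 0 \<longrightarrow> d \<bullet> e \<le> 0)"
  obtain m where m: "\<And>J. m J > 0" "\<And>J d. ?D J d \<Longrightarrow> m J \<le> c \<bullet> d"
    using outward_normal_cost_pos[of _ a c] by metis
  define \<mu> where "\<mu> = Min (m ` Pow I)"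
  have "\<mu> > 0"
    using m(1) \<open>finite I\<close> by (subst \<mu>_def, subst Min_gr_iff) auto
  have "X = (\<Inter>i\<in>I. {x. a i \<bullet> x \<le> \<beta> i})"
    by (auto simp: X_def)
  then have "closed X" "convex X"
    by (auto intro!: closed_INT closed_halfspace_le convex_INT convex_halfspace_le)
  have "\<mu> * infdist x ?S \<le> c \<bullet> x - c \<bullet> s" if x: "x \<in> X" and s: "s \<in> ?S" for x s
  proof -
    define q where "q = closest_point ?S x"
    have S: "closed ?S" "convex ?S" "?S \<noteq> {}"
      using closed_minimizers[OF \<open>closed X\<close>] convex_minimizers[OF \<open>convex X\<close>] s by auto
    have q: "q \<in> ?S"
      unfolding q_def using closest_point_in_set S by blast
    then have cq: "c \<bullet> q = c \<bullet> s"
      using s by (auto simp: minimizers_def intro: antisym)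
    have qX: "q \<in> X"
      using q by (simp add: minimizers_def)
    have dist: "infdist x ?S = norm (x - q)"
      using infdist_closest_point[OF S(1,3)] by (simp add: q_def dist_norm)
    show ?thesis
    proof (cases "x = q")
      case True
      then show ?thesis
        using cq dist by simp
    next
      case False
      define J where "J = {i\<in>I. a i \<bullet> q = \<beta> i}"
      define d where "d = (1 / norm (x - q)) *\<^sub>R (x - q)"
      have n: "norm (x - q) > 0"
        using False by simp
      have "a i \<bullet> (x - q) \<le> 0" if "i \<in> J" for i
        using that x by (auto simp: J_def X_def inner_diff_right)
      then have d1: "a i \<bullet> d \<le> 0" if "i \<in> J" for i
        using that n by (auto simp: d_def divide_nonpos_nonneg)
      have d2: "d \<bullet> e \<le> 0" if e: "\<forall>i\<in>J. a i \<bullet> e \<le> 0" "c \<bullet> e \<le> 0" for e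
      proof -
        \<comment> \<open>A short step along \<open>e\<close> stays feasible: it violates no active constraint, and the slack
          of the others is positive.\<close>
        have ev: "\<forall>\<^sub>F t in at_right 0. a i \<bullet> (q + t *\<^sub>R e) \<le> \<beta> i" if i: "i \<in> I" for i
        proof (cases "i \<in> J")
          case True
          have "\<forall>\<^sub>F t in at_right 0. (t::real) > 0"
            by (rule eventually_at_right_less)
          then show ?thesis
            by eventually_elim
              (use True e in \<open>auto simp: J_def inner_add_right mult_nonneg_nonpos\<close>)
        next
          case False
          then have "a i \<bullet> q < \<beta> i"
            using i qX by (force simp: J_def X_def)
          moreover have "((\<lambda>t. a i \<bullet> (q + t *\<^sub>R e)) \<longlongrightarrow> a i \<bullet> (q + 0 *\<^sub>R e)) (at_right 0)"
            by (intro tendsto_intros)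
          ultimately have "\<forall>\<^sub>F t in at_right 0. a i \<bullet> (q + t *\<^sub>R e) < \<beta> i"
            by (intro order_tendstoD(2)) auto
          then show ?thesis
            by eventually_elim simp
        qed
        have "\<forall>\<^sub>F t in at_right 0. q + t *\<^sub>R e \<in> X"
          using ev by (simp add: X_def eventually_ball_finite_distrib[OF \<open>finite I\<close>])
        moreover have "\<forall>\<^sub>F t in at_right 0. (t::real) > 0"
          by (rule eventually_at_right_less)
        ultimately have "\<forall>\<^sub>F t in at_right 0. q + t *\<^sub>R e \<in> X \<and> (t::real) > 0"
          by (rule eventually_conj)
        then obtain t :: real where t: "q + t *\<^sub>R e \<in> X" "t > 0"
          using eventually_happens trivial_limit_at_right_real by blast
        have "t * (c \<bullet> e) \<le> 0"
          using t e(2) by (simp add: mult_nonneg_nonpos)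
        then have "q + t *\<^sub>R e \<in> ?S"
          using t(1) cq by (simp add: minimizers_eq_sublevel[OF s] inner_add_right)
        then have "(x - q) \<bullet> ((q + t *\<^sub>R e) - q) \<le> 0"
          unfolding q_def by (intro closest_point_dot S)
        then show ?thesis
          using t n by (simp add: d_def mult_le_0_iff divide_nonpos_pos)
      qed
      have "?D J d"
        using d1 d2 n by (auto simp: d_def)
      then have "m J \<le> c \<bullet> d"
        by (rule m(2))
      moreover have "\<mu> \<le> m J"
        unfolding \<mu>_def using \<open>finite I\<close> by (intro Min_le) (auto simp: J_def)
      ultimately have "\<mu> \<le> c \<bullet> (x - q) / norm (x - q)"
        by (simp add: d_def)
      then show ?thesis
        using n cq by (simp add: dist field_simps inner_diff_right)
    qed
  qed
  then show ?thesis
    using \<open>\<mu> > 0\<close> by blast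
qed


section \<open>The Douglas-Rachford map of a linear cost over a convex set\<close>

definition dr_step :: "'a::euclidean_space set \<Rightarrow> 'a \<Rightarrow> real \<Rightarrow> real \<Rightarrow> 'a \<Rightarrow> 'a" where
  "dr_step X c \<alpha> \<gamma> x =
     (1 - 2*\<alpha>) *\<^sub>R x + (2*\<alpha>) *\<^sub>R closest_point X x - (2*\<alpha>*\<gamma>) *\<^sub>R c"

lemma dr_step_displacement:
  "dr_step X c \<alpha> \<gamma> x - x = (2*\<alpha>) *\<^sub>R (closest_point X x - x - \<gamma> *\<^sub>R c)"
  by (simp add: dr_step_def algebra_simps scaleR_2)

text \<open>
  With \<open>u = x - z\<close> and \<open>p\<close> the difference of the projections of \<open>x\<close> and \<open>z\<close>, the step sends \<open>u\<close> to
  \<open>u + 2\<alpha> (p - u)\<close>. Firm nonexpansiveness says \<open>u \<bullet> (p - u) \<le> - \<parallel>p - u\<parallel>\<^sup>2\<close>, so expanding the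
  square leaves \<open>\<parallel>u\<parallel>\<^sup>2 - 4\<alpha>(1 - \<alpha>) \<parallel>p - u\<parallel>\<^sup>2\<close>, where \<open>2\<alpha> (p - u)\<close> is the displacement.
\<close>

lemma dr_step_fejer:
  fixes X :: "'a::euclidean_space set"
  assumes X: "convex X" "closed X" "X \<noteq> {}" and "\<alpha> > 0"
    and z: "dr_step X c \<alpha> \<gamma> z = z"
  shows "(norm (dr_step X c \<alpha> \<gamma> x - z))\<^sup>2
    \<le> (norm (x - z))\<^sup>2 - (1 - \<alpha>) / \<alpha> * (norm (dr_step X c \<alpha> \<gamma> x - x))\<^sup>2"
proof -
  define u where "u = x - z"
  define p where "p = closest_point X x - closest_point X z"
  have "(2*\<alpha>) *\<^sub>R (closest_point X z - z - \<gamma> *\<^sub>R c) = 0"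
    using z dr_step_displacement[of X c \<alpha> \<gamma> z] by simp
  then have cz: "\<gamma> *\<^sub>R c = closest_point X z - z"
    using \<open>\<alpha> > 0\<close> by simp
  have disp: "dr_step X c \<alpha> \<gamma> x - x = (2*\<alpha>) *\<^sub>R (p - u)"
    unfolding dr_step_displacement cz by (simp add: p_def u_def)
  then have step: "dr_step X c \<alpha> \<gamma> x - z = u + (2*\<alpha>) *\<^sub>R (p - u)"
    by (simp add: u_def diff_eq_eq algebra_simps)
  have "p \<bullet> p \<le> p \<bullet> u"
    using closest_point_firmly_nonexpansive[OF X, of x z]
    by (simp add: p_def u_def power2_norm_eq_inner)
  then have "u \<bullet> (p - u) \<le> - ((p - u) \<bullet> (p - u))"
    by (simp add: algebra_simps inner_commute)
  then have "4 * \<alpha> * (u \<bullet> (p - u)) \<le> - (4 * \<alpha> * ((p - u) \<bullet> (p - u)))"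
    using \<open>\<alpha> > 0\<close> mult_left_mono[of "u \<bullet> (p - u)" "- ((p - u) \<bullet> (p - u))" "4 * \<alpha>"] by simp
  moreover have "(norm (u + (2*\<alpha>) *\<^sub>R (p - u)))\<^sup>2
      = (norm u)\<^sup>2 + 4 * \<alpha> * (u \<bullet> (p - u)) + 4 * \<alpha>\<^sup>2 * ((p - u) \<bullet> (p - u))"
    unfolding power2_norm_eq_inner
    by (simp add: inner_add_left inner_add_right inner_commute power2_eq_square)
  moreover have "(1 - \<alpha>) / \<alpha> * (norm ((2*\<alpha>) *\<^sub>R (p - u)))\<^sup>2
      = 4 * \<alpha> * ((p - u) \<bullet> (p - u)) - 4 * \<alpha>\<^sup>2 * ((p - u) \<bullet> (p - u))"
    using \<open>\<alpha> > 0\<close> unfolding norm_scaleR power_mult_distrib power2_norm_eq_inner[of "p - u"]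
    by (simp add: field_simps power2_eq_square)
  ultimately show ?thesis
    unfolding step disp u_def[symmetric] by linarith
qed

text \<open>
  A fixed point is an \<open>x\<close> whose projection onto \<open>X\<close> is \<open>x + \<gamma> c\<close>. By the variational
  characterization of the projection this means that \<open>- c\<close> is normal to \<open>X\<close> at \<open>x + \<gamma> c\<close>, which is
  the optimality condition for the linear cost.
\<close>

lemma dr_step_fixed_point_iff:
  fixes X :: "'a::euclidean_space set"
  assumes X: "convex X" "closed X" "X \<noteq> {}" and "\<alpha> > 0" "\<gamma> > 0"
  shows "dr_step X c \<alpha> \<gamma> x = x \<longleftrightarrow> x + \<gamma> *\<^sub>R c \<in> minimizers c X"
proof -
  have "dr_step X c \<alpha> \<gamma> x = x \<longleftrightarrow> (2*\<alpha>) *\<^sub>R (closest_point X x - x - \<gamma> *\<^sub>R c) = 0"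
    by (metis dr_step_displacement eq_iff_diff_eq_0)
  also have "\<dots> \<longleftrightarrow> closest_point X x = x + \<gamma> *\<^sub>R c"
    using \<open>\<alpha> > 0\<close> by (simp add: diff_diff_eq)
  also have "\<dots> \<longleftrightarrow> x + \<gamma> *\<^sub>R c \<in> minimizers c X"
  proof
    assume eq: "closest_point X x = x + \<gamma> *\<^sub>R c"
    have "c \<bullet> (x + \<gamma> *\<^sub>R c) \<le> c \<bullet> u" if "u \<in> X" for u
    proof -
      have "(x - closest_point X x) \<bullet> (u - closest_point X x) \<le> 0"
        using X that by (simp add: closest_point_dot)
      then have "\<gamma> * (c \<bullet> (u - (x + \<gamma> *\<^sub>R c))) \<ge> 0"
        by (simp add: eq)
      then show ?thesis
        using \<open>\<gamma> > 0\<close> by (simp add: zero_le_mult_iff inner_diff_right)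
    qed
    then show "x + \<gamma> *\<^sub>R c \<in> minimizers c X"
      using closest_point_in_set[OF X(2,3), of x] by (simp add: minimizers_def eq)
  next
    assume s: "x + \<gamma> *\<^sub>R c \<in> minimizers c X"
    show "closest_point X x = x + \<gamma> *\<^sub>R c"
    proof (rule closest_point_eqI[OF X(1,2)])
      show "x + \<gamma> *\<^sub>R c \<in> X"
        using s by (simp add: minimizers_def)
      fix u assume "u \<in> X"
      then have "c \<bullet> (u - (x + \<gamma> *\<^sub>R c)) \<ge> 0"
        using s by (simp add: minimizers_def inner_diff_right)
      then show "(x - (x + \<gamma> *\<^sub>R c)) \<bullet> (u - (x + \<gamma> *\<^sub>R c)) \<le> 0"
        using \<open>\<gamma> > 0\<close> by simp
    qed
  qed
  finally show ?thesis .
qed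

text \<open>
  A linear cost over a closed convex set with a weak sharp minimum of modulus \<open>\<mu>\<close>. Within distance
  \<open>\<gamma> \<mu>\<close> of the fixed points such a set is as good as a polyhedron.
\<close>

locale dr_sharp_program =
  fixes X :: "'a::euclidean_space set" and c :: 'a and \<mu> \<alpha> \<gamma> :: real
  assumes convex: "convex X" and closed: "closed X"
    and solvable: "minimizers c X \<noteq> {}"
    and \<mu>_pos: "\<mu> > 0"
    and sharp: "\<And>x s. x \<in> X \<Longrightarrow> s \<in> minimizers c X \<Longrightarrow>
      \<mu> * infdist x (minimizers c X) \<le> c \<bullet> x - c \<bullet> s"
    and \<alpha>: "0 < \<alpha>" "\<alpha> < 1" and \<gamma>: "0 < \<gamma>"
begin

abbreviation "S \<equiv> minimizers c X"
abbreviation "T \<equiv> dr_step X c \<alpha> \<gamma>"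

lemma nonempty: "X \<noteq> {}"
  using solvable by (auto simp: minimizers_def)

lemma closed_S: "closed S" and convex_S: "convex S"
  using closed_minimizers closed convex_minimizers convex by auto

lemma fixed_points_T: "fixed_points T = {x. x + \<gamma> *\<^sub>R c \<in> S}"
  using dr_step_fixed_point_iff[OF convex closed nonempty \<alpha>(1) \<gamma>] by (simp add: fixed_points_def)

lemma infdist_fixed_points: "infdist x (fixed_points T) = infdist (x + \<gamma> *\<^sub>R c) S"
  by (simp add: fixed_points_T infdist_translated_set)

lemma fixed_points_nonempty: "fixed_points T \<noteq> {}"
proof -
  obtain s where "s \<in> S"
    using solvable by blast
  then have "s - \<gamma> *\<^sub>R c \<in> fixed_points T"
    by (simp add: fixed_points_T)
  then show ?thesis
    by blast
qed

text \<open>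
  Let \<open>p\<close> and \<open>q\<close> be the projections of \<open>y\<close> and of a feasible \<open>u\<close> onto \<open>S\<close>. To see that \<open>p\<close> is also the
  projection of \<open>y - \<gamma> c\<close> onto \<open>X\<close>, split \<open>u - p\<close> at \<open>q\<close>: the vector \<open>y - p\<close> makes no acute angle
  with \<open>q - p\<close>, and its product with \<open>u - q\<close> is at most \<open>\<gamma> \<mu> dist(u, S)\<close>, which the sharp minimum
  bounds by the excess cost that \<open>\<gamma> c\<close> charges.
\<close>

lemma closest_point_shifted:
  assumes near: "infdist y S \<le> \<gamma> * \<mu>"
  shows "closest_point X (y - \<gamma> *\<^sub>R c) = closest_point S y"
proof (rule closest_point_eqI[OF convex closed])
  define p where "p = closest_point S y"
  have p: "p \<in> S"
    unfolding p_def by (rule closest_point_in_set[OF closed_S solvable])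
  then show "closest_point S y \<in> X"
    by (simp add: p_def minimizers_def)
  have yp: "norm (y - p) \<le> \<gamma> * \<mu>"
    using near infdist_closest_point[OF closed_S solvable, of y] by (simp add: p_def dist_norm)
  fix u assume "u \<in> X"
  define q where "q = closest_point S u"
  have q: "q \<in> S"
    unfolding q_def by (rule closest_point_in_set[OF closed_S solvable])
  have dist: "infdist u S = norm (u - q)"
    using infdist_closest_point[OF closed_S solvable, of u] by (simp add: q_def dist_norm)
  have "(y - p) \<bullet> (q - p) \<le> 0"
    unfolding p_def by (rule closest_point_dot[OF convex_S closed_S q])
  moreover have "(y - p) \<bullet> (u - q) \<le> \<gamma> * \<mu> * norm (u - q)"
    using norm_cauchy_schwarz[of "y - p" "u - q"] mult_right_mono[OF yp, of "norm (u - q)"] by simp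
  moreover have "\<gamma> * (\<mu> * norm (u - q)) \<le> \<gamma> * (c \<bullet> u - c \<bullet> p)"
    using sharp[OF \<open>u \<in> X\<close> p] \<gamma> by (intro mult_left_mono) (auto simp: dist)
  moreover have "(y - \<gamma> *\<^sub>R c - p) \<bullet> (u - p)
      = (y - p) \<bullet> (q - p) + (y - p) \<bullet> (u - q) - \<gamma> * (c \<bullet> u - c \<bullet> p)"
    by (simp add: algebra_simps)
  ultimately have "(y - \<gamma> *\<^sub>R c - p) \<bullet> (u - p) \<le> 0"
    by simp
  then show "(y - \<gamma> *\<^sub>R c - closest_point S y) \<bullet> (u - closest_point S y) \<le> 0"
    by (simp add: p_def)
qed

lemma norm_displacement:
  assumes "infdist x (fixed_points T) \<le> \<gamma> * \<mu>"
  shows "norm (T x - x) = 2 * \<alpha> * infdist x (fixed_points T)"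
proof -
  let ?y = "x + \<gamma> *\<^sub>R c"
  have "closest_point X x = closest_point S ?y"
    using closest_point_shifted[of ?y] assms by (simp add: infdist_fixed_points)
  then have "T x - x = (2*\<alpha>) *\<^sub>R (closest_point S ?y - ?y)"
    by (simp add: dr_step_displacement algebra_simps)
  then show ?thesis
    using \<alpha> infdist_closest_point[OF closed_S solvable, of ?y]
    by (simp add: infdist_fixed_points dist_norm norm_minus_commute)
qed

lemma error_bound_T:
  assumes "0 < R" "R \<le> \<gamma> * \<mu>"
  shows "error_bound T R (1 / (2*\<alpha>))"
  using assms norm_displacement \<alpha> by (auto simp: error_bound_def)

text \<open>
  Near the fixed points the displacement is an exact multiple of the distance, so it suffices to
  find a point whose distance to the fixed points is positive and small. On the segment from a
  point that is not fixed to its nearest fixed point the distance takes all intermediate values.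
\<close>

lemma error_bound_constant_optimal:
  assumes eb: "error_bound T R K" and nontrivial: "fixed_points T \<noteq> UNIV"
  shows "1 / (2*\<alpha>) \<le> K"
proof -
  let ?F = "fixed_points T"
  have R: "R > 0"
    using eb by (simp add: error_bound_def)
  obtain y where "y \<notin> ?F"
    using nontrivial by blast
  have "closed ?F"
    using continuous_closed_vimage[OF closed_S, of "\<lambda>x. x + \<gamma> *\<^sub>R c"]
    by (simp add: fixed_points_T vimage_def)
  define p where "p = closest_point ?F y"
  have p: "p \<in> ?F"
    unfolding p_def by (rule closest_point_in_set[OF \<open>closed ?F\<close> fixed_points_nonempty])
  have n: "norm (y - p) > 0"
    using p \<open>y \<notin> ?F\<close> by auto
  let ?D = "\<lambda>t::real. infdist (p + t *\<^sub>R (y - p)) ?F"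
  have "continuous_on {0..1} ?D"
    by (intro continuous_intros)
  moreover have "?D 0 = 0"
    using p by simp
  moreover have "?D 1 > 0"
    using infdist_pos_not_in_closed[OF \<open>closed ?F\<close> fixed_points_nonempty \<open>y \<notin> ?F\<close>] by simp
  moreover define e where "e = min (?D 1) (min R (\<gamma> * \<mu>))"
  ultimately obtain t where "?D t = e"
    using IVT'[of ?D 0 e 1] R \<mu>_pos \<gamma> by auto
  then obtain x where x: "infdist x ?F = e"
    by blast
  have e: "0 < e" "e \<le> R" "e \<le> \<gamma> * \<mu>"
    using R \<mu>_pos \<gamma> \<open>?D 1 > 0\<close> by (auto simp: e_def)
  have "e \<le> K * (2 * \<alpha> * e)"
    using eb x e norm_displacement[of x] by (auto simp: error_bound_def)
  then show ?thesis
    using e \<alpha> by (simp add: field_simps)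
qed

text \<open>
  With \<open>\<kappa> = (1 - \<alpha>)/\<alpha>\<close> and \<open>K = 1/(2\<alpha>)\<close>, the factor \<open>1 - \<kappa>/K\<^sup>2\<close> is \<open>1 - 4\<alpha>(1 - \<alpha>)\<close>, which is at
  most the square of \<open>1 - 2\<alpha>(1 - \<alpha>)\<close>. For \<open>\<alpha> = 1/2\<close> this factor vanishes, so that its root would
  not be an admissible rate in \<open>error_bound_imp_linear_convergence\<close>.
\<close>

lemma linear_convergence_T:
  assumes "0 < R" "R \<le> \<gamma> * \<mu>"
  shows "converges_linearly_with_rate T R (1 - 2*\<alpha>*(1 - \<alpha>))"
proof (rule error_bound_imp_linear_convergence[OF _ fixed_points_nonempty _ _ error_bound_T[OF assms]])
  show "continuous_on UNIV T"
    unfolding dr_step_def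
    by (intro continuous_intros continuous_on_closest_point convex closed nonempty)
  show "(1 - \<alpha>) / \<alpha> > 0"
    using \<alpha> by simp
  show "(norm (T x - z))\<^sup>2 \<le> (norm (x - z))\<^sup>2 - (1 - \<alpha>) / \<alpha> * (norm (T x - x))\<^sup>2"
    if "z \<in> fixed_points T" for x z
    using dr_step_fejer[OF convex closed nonempty \<alpha>(1), of c \<gamma> z x] that
    by (simp add: fixed_points_def)
  have "\<alpha> * (1 - \<alpha>) > 0"
    using \<alpha> by simp
  then show "1 - 2*\<alpha>*(1 - \<alpha>) < 1"
    by linarith
  have "1 - 2*\<alpha>*(1 - \<alpha>) = \<alpha>\<^sup>2 + (1 - \<alpha>)\<^sup>2"
    by (simp add: algebra_simps power2_eq_square)
  then show "0 < 1 - 2*\<alpha>*(1 - \<alpha>)"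
    using \<alpha> by (simp add: add_pos_pos)
  have "1 - (1 - \<alpha>) / \<alpha> / (1 / (2*\<alpha>))\<^sup>2 = 1 - 4 * (\<alpha> * (1 - \<alpha>))"
    using \<alpha> by (simp add: field_simps power2_eq_square)
  also have "\<dots> \<le> (1 - 2*\<alpha>*(1 - \<alpha>))\<^sup>2"
    using zero_le_power2[of "2 * (\<alpha> * (1 - \<alpha>))"] by (simp add: power2_diff power_mult_distrib)
  finally show "1 - (1 - \<alpha>) / \<alpha> / (1 / (2*\<alpha>))\<^sup>2 \<le> (1 - 2*\<alpha>*(1 - \<alpha>))\<^sup>2" .
qed

end

section \<open>Proximal operators and the two algorithms\<close>

lemma arg_min_strict_eq:
  fixes f :: "'a \<Rightarrow> 'b::order"
  assumes "\<And>u. u \<noteq> p \<Longrightarrow> f p < f u"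
  shows "arg_min f (\<lambda>u. True) = p"
  unfolding arg_min_def is_arg_min_def
proof (rule some_equality)
  show "True \<and> \<not> (\<exists>y. True \<and> f y < f p)"
    using assms by (metis less_asym' less_irrefl)
qed (use assms in blast)

lemma prox_set_indicator:
  fixes X :: "'a::euclidean_space set"
  assumes X: "convex X" "closed X" "X \<noteq> {}" and "\<gamma> > 0"
  shows "prox \<gamma> (set_indicator X) x = closest_point X x"
  unfolding prox_def
proof (rule arg_min_strict_eq)
  fix u assume u: "u \<noteq> closest_point X x"
  show "ereal \<gamma> * set_indicator X (closest_point X x)
        + ereal (1/2 * (norm (closest_point X x - x))\<^sup>2)
      < ereal \<gamma> * set_indicator X u + ereal (1/2 * (norm (u - x))\<^sup>2)"
  proof (cases "u \<in> X")
    case True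
    then have "norm (closest_point X x - x) < norm (u - x)"
      using closest_point_lt[OF X(1,2) True u] by (simp add: dist_norm norm_minus_commute)
    then have "(norm (closest_point X x - x))\<^sup>2 < (norm (u - x))\<^sup>2"
      by (intro power_strict_mono) auto
    then show ?thesis
      using True closest_point_in_set[OF X(2,3), of x] by (simp add: set_indicator_def)
  next
    case False
    then show ?thesis
      using \<open>\<gamma> > 0\<close> closest_point_in_set[OF X(2,3), of x] by (simp add: set_indicator_def)
  qed
qed

text \<open>
  Completing the square: the objective exceeds its value at \<open>x - \<gamma> c\<close> by half the squared distance
  to that point.
\<close>

lemma prox_linear_cost:
  fixes c :: "'a::real_inner"
  shows "prox \<gamma> (linear_cost c) x = x - \<gamma> *\<^sub>R c"
  unfolding prox_def
proof (rule arg_min_strict_eq)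
  fix u assume "u \<noteq> x - \<gamma> *\<^sub>R c"
  then have "(norm (u - (x - \<gamma> *\<^sub>R c)))\<^sup>2 > 0"
    by simp
  moreover have "\<gamma> * (c \<bullet> u) + 1/2 * (norm (u - x))\<^sup>2
      = (\<gamma> * (c \<bullet> (x - \<gamma> *\<^sub>R c)) + 1/2 * (norm (x - \<gamma> *\<^sub>R c - x))\<^sup>2)
        + 1/2 * (norm (u - (x - \<gamma> *\<^sub>R c)))\<^sup>2"
    unfolding power2_norm_eq_inner by (simp add: algebra_simps inner_commute)
  ultimately show "ereal \<gamma> * linear_cost c (x - \<gamma> *\<^sub>R c)
        + ereal (1/2 * (norm (x - \<gamma> *\<^sub>R c - x))\<^sup>2)
      < ereal \<gamma> * linear_cost c u + ereal (1/2 * (norm (u - x))\<^sup>2)"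
    unfolding linear_cost_def times_ereal.simps plus_ereal.simps less_ereal.simps by linarith
qed

lemma dr_operator_eq_dr_step:
  fixes X :: "'a::euclidean_space set"
  assumes X: "convex X" "closed X" "X \<noteq> {}" and "\<gamma> > 0"
  shows "dr_operator \<alpha> \<gamma> (set_indicator X) (linear_cost c) = dr_step X c \<alpha> \<gamma>"
  by (rule ext)
    (simp add: dr_operator_def refl_prox_def prox_linear_cost prox_set_indicator[OF assms]
      dr_step_def algebra_simps flip: scaleR_add_left)

text \<open>
  Substituting \<open>\<beta> u\<close> and dividing by \<open>\<beta>\<close> turns the projection onto \<open>X\<close> into the projection onto
  \<open>X\<close> scaled by \<open>1/\<beta>\<close>, and the shift \<open>\<beta> c\<close> into \<open>c\<close>, which is the shift for step 1.
\<close>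

lemma admm_operator_eq_dr_step:
  fixes X :: "'a::euclidean_space set"
  assumes X: "convex X" "closed X" "X \<noteq> {}" and "\<beta> > 0"
  shows "admm_operator \<beta> (set_indicator X) (linear_cost c)
    = dr_step ((*\<^sub>R) (1/\<beta>) ` X) c (1/2) 1"
proof
  fix u
  have "admm_operator \<beta> (set_indicator X) (linear_cost c) u
      = (1/\<beta>) *\<^sub>R dr_operator (1/2) \<beta> (set_indicator X) (linear_cost c) (\<beta> *\<^sub>R u)"
    by (simp add: admm_operator_def dr_operator_def)
  also have "\<dots> = (1/\<beta>) *\<^sub>R closest_point X (\<beta> *\<^sub>R u) - c"
    using \<open>\<beta> > 0\<close> by (simp add: dr_operator_eq_dr_step[OF assms] dr_step_def scaleR_diff_right)
  also have "\<dots> = dr_step ((*\<^sub>R) (1/\<beta>) ` X) c (1/2) 1 u"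
    using \<open>\<beta> > 0\<close> closest_point_scaled_image[OF X, of "1/\<beta>" "\<beta> *\<^sub>R u"]
    by (simp add: dr_step_def)
  finally show "admm_operator \<beta> (set_indicator X) (linear_cost c) u
    = dr_step ((*\<^sub>R) (1/\<beta>) ` X) c (1/2) 1 u" .
qed

section \<open>Douglas-Rachford and ADMM for linear programs\<close>

lemma feasible_set_eq_row_halfspaces:
  "feasible_set A b = {x. \<forall>i\<in>UNIV. row i A \<bullet> x \<le> b $ i}"
  by (simp add: feasible_set_def less_eq_vec_def matrix_vector_mul_component row_def)

lemma feasible_set_scaled_rhs:
  assumes "t > 0"
  shows "feasible_set A (t *\<^sub>R b) = (*\<^sub>R) t ` feasible_set A b"
proof
  show "(*\<^sub>R) t ` feasible_set A b \<subseteq> feasible_set A (t *\<^sub>R b)"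
    using assms by (auto simp: feasible_set_eq_row_halfspaces)
  show "feasible_set A (t *\<^sub>R b) \<subseteq> (*\<^sub>R) t ` feasible_set A b"
  proof
    fix x assume "x \<in> feasible_set A (t *\<^sub>R b)"
    then have "(1/t) *\<^sub>R x \<in> feasible_set A b"
      using assms by (auto simp: feasible_set_eq_row_halfspaces field_simps)
    then show "x \<in> (*\<^sub>R) t ` feasible_set A b"
      using assms by (intro image_eqI[of _ _ "(1/t) *\<^sub>R x"]) auto
  qed
qed

lemma closed_feasible_set: "closed (feasible_set A b)"
  and convex_feasible_set: "convex (feasible_set A b)"
proof -
  have "feasible_set A b = (\<Inter>i. {x. row i A \<bullet> x \<le> b $ i})"
    by (auto simp: feasible_set_eq_row_halfspaces)
  then show "closed (feasible_set A b)" "convex (feasible_set A b)"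
    by (auto intro!: closed_INT closed_halfspace_le convex_INT convex_halfspace_le)
qed

lemma lp_dr_sharp_program:
  assumes "minimizers c (feasible_set A b) \<noteq> {}" and "0 < \<alpha>" "\<alpha> < 1" "0 < \<gamma>"
  shows "\<exists>\<mu>. dr_sharp_program (feasible_set A b) c \<mu> \<alpha> \<gamma>"
  using polyhedron_sharp_minimum[OF finite_class.finite_UNIV feasible_set_eq_row_halfspaces, of A b c]
    assms closed_feasible_set convex_feasible_set unfolding dr_sharp_program_def by blast

lemma sqrt_relaxation_le:
  fixes \<alpha> :: real
  assumes "0 < \<alpha>"
  shows "sqrt ((1 - \<alpha>) / \<alpha>) \<le> 1 / (2*\<alpha>)"
proof (rule real_le_lsqrt)
  have "4 * \<alpha> * (1 - \<alpha>) \<le> 1"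
    using zero_le_power2[of "1 - 2*\<alpha>"] by (simp add: power2_eq_square algebra_simps)
  then have "4 * \<alpha> * (1 - \<alpha>) / (2*\<alpha>)\<^sup>2 \<le> 1 / (2*\<alpha>)\<^sup>2"
    by (rule divide_right_mono) simp
  then show "(1 - \<alpha>) / \<alpha> \<le> (1 / (2*\<alpha>))\<^sup>2"
    using assms by (simp add: power_divide power_mult_distrib power2_eq_square)
qed (use assms in auto)

theorem theorem6:
  fixes A :: "real^'n^'m" and b :: "real^'m" and c :: "real^'n"
    and \<alpha> \<gamma> \<beta> :: real
  assumes "CARD('n) \<le> CARD('m)"
    and "\<exists>x \<in> feasible_set A b. \<forall>y \<in> feasible_set A b. c \<bullet> x \<le> c \<bullet> y"
    and "0 < \<alpha>" and "\<alpha> < 1" and "0 < \<gamma>" and "0 < \<beta>"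
  shows
    "(\<forall>x. DR_LP A b c \<alpha> \<gamma> x =
        (1 - 2*\<alpha>) *\<^sub>R x + (2*\<alpha>) *\<^sub>R closest_point (feasible_set A b) x - (2*\<alpha>*\<gamma>) *\<^sub>R c) \<and>
     (\<exists>K r R0. sqrt ((1 - \<alpha>) / \<alpha>) \<le> K \<and> K \<le> 1 / (2*\<alpha>) \<and>
        r \<le> 1 - 2*\<alpha>*(1 - \<alpha>) \<and> R0 > 0 \<and>
        (\<forall>R. 0 < R \<and> R \<le> R0 \<longrightarrow>
           error_bound (DR_LP A b c \<alpha> \<gamma>) R K \<and>
           (fixed_points (DR_LP A b c \<alpha> \<gamma>) \<noteq> UNIV \<longrightarrow>
              (\<forall>K'. error_bound (DR_LP A b c \<alpha> \<gamma>) R K' \<longrightarrow> sqrt ((1 - \<alpha>) / \<alpha>) \<le> K')) \<and>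
           converges_linearly_with_rate (DR_LP A b c \<alpha> \<gamma>) R r)) \<and>
     (\<exists>r R0. r \<le> 1/2 \<and> R0 > 0 \<and>
        (\<forall>R. 0 < R \<and> R \<le> R0 \<longrightarrow>
           error_bound (ADMM_LP A b c \<beta>) R 1 \<and>
           (fixed_points (ADMM_LP A b c \<beta>) \<noteq> UNIV \<longrightarrow>
              (\<forall>K'. error_bound (ADMM_LP A b c \<beta>) R K' \<longrightarrow> 1 \<le> K')) \<and>
           converges_linearly_with_rate (ADMM_LP A b c \<beta>) R r))"
proof -
  let ?X = "feasible_set A b"
  have sol: "minimizers c ?X \<noteq> {}"
    using assms(2) by (auto simp: minimizers_def)
  then have X: "convex ?X" "closed ?X" "?X \<noteq> {}"
    using convex_feasible_set closed_feasible_set by (auto simp: minimizers_def)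
  have DR: "DR_LP A b c \<alpha> \<gamma> = dr_step ?X c \<alpha> \<gamma>"
    unfolding DR_LP_def by (rule dr_operator_eq_dr_step[OF X \<open>0 < \<gamma>\<close>])
  obtain \<mu> where "dr_sharp_program ?X c \<mu> \<alpha> \<gamma>"
    using lp_dr_sharp_program[OF sol assms(3-5)] by blast
  then interpret dr: dr_sharp_program ?X c \<mu> \<alpha> \<gamma> .
  have R0: "\<gamma> * \<mu> > 0"
    using dr.\<mu>_pos \<open>0 < \<gamma>\<close> by simp
  have part2: "\<exists>K r R0. sqrt ((1 - \<alpha>) / \<alpha>) \<le> K \<and> K \<le> 1 / (2*\<alpha>) \<and>
        r \<le> 1 - 2*\<alpha>*(1 - \<alpha>) \<and> R0 > 0 \<and>
        (\<forall>R. 0 < R \<and> R \<le> R0 \<longrightarrow>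
           error_bound (DR_LP A b c \<alpha> \<gamma>) R K \<and>
           (fixed_points (DR_LP A b c \<alpha> \<gamma>) \<noteq> UNIV \<longrightarrow>
              (\<forall>K'. error_bound (DR_LP A b c \<alpha> \<gamma>) R K' \<longrightarrow> sqrt ((1 - \<alpha>) / \<alpha>) \<le> K')) \<and>
           converges_linearly_with_rate (DR_LP A b c \<alpha> \<gamma>) R r)"
  proof (intro exI conjI allI impI)
    show "sqrt ((1 - \<alpha>) / \<alpha>) \<le> 1 / (2*\<alpha>)"
      by (rule sqrt_relaxation_le[OF \<open>0 < \<alpha>\<close>])
    show "\<gamma> * \<mu> > 0"
      by (rule R0)
    fix R assume R: "0 < R \<and> R \<le> \<gamma> * \<mu>"
    then show "error_bound (DR_LP A b c \<alpha> \<gamma>) R (1 / (2*\<alpha>))"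
      unfolding DR by (intro dr.error_bound_T) auto
    show "converges_linearly_with_rate (DR_LP A b c \<alpha> \<gamma>) R (1 - 2*\<alpha>*(1 - \<alpha>))"
      unfolding DR using R by (intro dr.linear_convergence_T) auto
    fix K' assume "fixed_points (DR_LP A b c \<alpha> \<gamma>) \<noteq> UNIV" "error_bound (DR_LP A b c \<alpha> \<gamma>) R K'"
    then have "1 / (2*\<alpha>) \<le> K'"
      unfolding DR by (intro dr.error_bound_constant_optimal)
    then show "sqrt ((1 - \<alpha>) / \<alpha>) \<le> K'"
      using sqrt_relaxation_le[OF \<open>0 < \<alpha>\<close>] by linarith
  qed auto
  let ?Y = "feasible_set A ((1/\<beta>) *\<^sub>R b)"
  have Y: "?Y = (*\<^sub>R) (1/\<beta>) ` ?X"
    using feasible_set_scaled_rhs[of "1/\<beta>"] \<open>0 < \<beta>\<close> by simp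
  have ADMM: "ADMM_LP A b c \<beta> = dr_step ?Y c (1/2) 1"
    unfolding ADMM_LP_def Y by (rule admm_operator_eq_dr_step[OF X \<open>0 < \<beta>\<close>])
  obtain s where "s \<in> minimizers c ?X"
    using sol by blast
  then have "(1/\<beta>) *\<^sub>R s \<in> minimizers c ?Y"
    using \<open>0 < \<beta>\<close> by (auto simp: Y minimizers_def divide_right_mono)
  then have solY: "minimizers c ?Y \<noteq> {}"
    by blast
  obtain \<nu> where "dr_sharp_program ?Y c \<nu> (1/2) 1"
    using lp_dr_sharp_program[OF solY, of "1/2" 1] by auto
  then interpret admm: dr_sharp_program ?Y c \<nu> "1/2" 1 .
  have part3: "\<exists>r R0. r \<le> 1/2 \<and> R0 > 0 \<and>
        (\<forall>R. 0 < R \<and> R \<le> R0 \<longrightarrow>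
           error_bound (ADMM_LP A b c \<beta>) R 1 \<and>
           (fixed_points (ADMM_LP A b c \<beta>) \<noteq> UNIV \<longrightarrow>
              (\<forall>K'. error_bound (ADMM_LP A b c \<beta>) R K' \<longrightarrow> 1 \<le> K')) \<and>
           converges_linearly_with_rate (ADMM_LP A b c \<beta>) R r)"
  proof (intro exI conjI allI impI)
    show "\<nu> > 0"
      by (rule admm.\<mu>_pos)
    fix R assume R: "0 < R \<and> R \<le> \<nu>"
    then show "error_bound (ADMM_LP A b c \<beta>) R 1"
      unfolding ADMM using admm.error_bound_T[of R] by simp
    show "converges_linearly_with_rate (ADMM_LP A b c \<beta>) R (1/2)"
      unfolding ADMM using R admm.linear_convergence_T[of R] by simp
    fix K' assume "fixed_points (ADMM_LP A b c \<beta>) \<noteq> UNIV" "error_bound (ADMM_LP A b c \<beta>) R K'"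
    then show "1 \<le> K'"
      unfolding ADMM using admm.error_bound_constant_optimal[of R K'] by simp
  qed simp
  have "\<forall>x. DR_LP A b c \<alpha> \<gamma> x =
      (1 - 2*\<alpha>) *\<^sub>R x + (2*\<alpha>) *\<^sub>R closest_point ?X x - (2*\<alpha>*\<gamma>) *\<^sub>R c"
    by (simp add: DR dr_step_def)
  then show ?thesis
    using part2 part3 by (intro conjI)
qed

end
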